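(* Let $n\ge1$ and let $\Theta=\{x_0,\dots,x_n\}\subset\mathbb{H}$ be a set of $n+1$ distinct points. Define $\ell_0,\dots,\ell_n:\mathbb{H}\to\mathbb{H}$ by either of the following two choices: (I) $\displaystyle \ell_j(x)=p_j(x)\,p_j(x_j)^{-1}$, where $p_j=p_{\{x_0,\dots,x_n\}\setminus\{x_j\}}$, provided that $p_j(x_j)\neq0$ for all $j$. Here, for points $y_1,\dots,y_n\in\mathbb{H}$, $$p_{\{y_1,\dots,y_n\}}(x)=\frac1{n!}\sum_{\sigma\in S_n}(x-y_{\sigma1})(x-y_{\sigma2})\cdots(x-y_{\sigma n}).$$ (II) $\displaystyle \ell_j(x)=\frac1{n!}\sum_{\sigma\in S_{n+1},\ \sigma j=j}\ \prod_{k\ne j}(x-x_{\sigma k})(x_j-x_{\sigma k})^{-1}$, where $S_{n+1}$ is the group of permutations of $\{0,1,\dots,n\}$ and the factors are multiplied in the order $k=0,1,\dots,n$ (omitting $k=j$). Let $L_\Theta$ be the operator on functions $f:\mathbb{H}\to\mathbb{H}$ given by $L_\Theta f(x)=\sum_{j=0}^n\ell_j(x)f(x_j)$. Then, for either choice, $L_\Theta$ is a Lagrange interpolation operator at $\Theta$, i.e., $L_\Theta f(x_j)=f(x_j)$ for $0\le j\le n$ and all $f$. It does not depend on the ordering of the points of $\Theta$. Moreover: 1. $L_\Theta$ depends continuously on the points $\Theta$, i.e., each $\ell_j\in\mathrm{Pol}_n(\mathbb{H})$ is a continuous function of $(x_0,\dots,x_n)$. 2. The interpolation space $\Pi_\Theta:=\operatorname{ran}(L_\Theta)$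 depends continuously on the points $\Theta$ (as an $(n+1)$-dimensional right $\mathbb{H}$-subspace of $\mathrm{Pol}_n(\mathbb{H})$). 3. $L_\Theta$ is translation invariant: for every $a\in\mathbb{H}$, every $f:\mathbb{H}\to\mathbb{H}$ and every $x\in\mathbb{H}$, $$L_{\Theta+a}f(x)=L_\Theta\bigl(f(\cdot+a)\bigr)(x-a).$$
   Context: $\mathbb{H}$ denotes the real quaternions. Spaces of functions $\mathbb{H}\to\mathbb{H}$ are regarded as right $\mathbb{H}$-vector spaces (right $\mathbb{H}$-modules), with $(f\alpha)(x)=f(x)\alpha$. A quaternionic monomial of degree $r$ is a function $q\mapsto\alpha_0q\alpha_1q\alpha_2\cdots q\alpha_{r-1}q\alpha_r$ with $\alpha_j\in\mathbb{H}$. $\mathrm{Hom}_r(\mathbb{H})$ is the $\mathbb{H}$-span of the monomials of degree $r$, and $\mathrm{Pol}_n(\mathbb{H})$ is the $\mathbb{H}$-span of all $\mathrm{Hom}_r(\mathbb{H})$ with $r\le n$. It is finite dimensional and carries its usual topology as a finite-dimensional real vector space. Continuity is with respect to $(x_0,\dots,x_n)$ ranging over $(n+1)$-tuples of distinct points, which for choice (I) must in addition satisfy $p_j(x_j)\ne0$ for all $j$. Continuity of the subspace $\Pi_\Theta$ is with respect to the usual topology on the Grassmannian of subspaces of the finite-dimensional space $\mathrm{Pol}_n(\mathbb{H})$. $\Theta+a=\{x_0+a,\dots,x_n+a\}$. *)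

theory Defs
  imports "HOL-Analysis.Analysis" "HOL-Library.Function_Algebras"
begin

section \<open>The quaternions\<close>

datatype quat = Quat (qRe: real) (qI: real) (qJ: real) (qK: real)

lemma quat_eq_iff:
  "x = y \<longleftrightarrow> qRe x = qRe y \<and> qI x = qI y \<and> qJ x = qJ y \<and> qK x = qK y"
  by (auto intro: quat.expand)

instantiation quat :: real_vector
begin

definition "0 = Quat 0 0 0 0"
definition "x + y = Quat (qRe x + qRe y) (qI x + qI y) (qJ x + qJ y) (qK x + qK y)"
definition "- x = Quat (- qRe x) (- qI x) (- qJ x) (- qK x)"
definition "x - y = Quat (qRe x - qRe y) (qI x - qI y) (qJ x - qJ y) (qK x - qK y)"
definition "r *\<^sub>R x = Quat (r * qRe x) (r * qI x) (r * qJ x) (r * qK x)"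

instance
  by standard
    (simp_all add: quat_eq_iff zero_quat_def plus_quat_def uminus_quat_def minus_quat_def
      scaleR_quat_def algebra_simps)

end

instantiation quat :: real_algebra_1
begin

definition "1 = Quat 1 0 0 0"

definition "x * y = Quat
  (qRe x * qRe y - qI x * qI y - qJ x * qJ y - qK x * qK y)
  (qRe x * qI y + qI x * qRe y + qJ x * qK y - qK x * qJ y)
  (qRe x * qJ y - qI x * qK y + qJ x * qRe y + qK x * qI y)
  (qRe x * qK y + qI x * qJ y - qJ x * qI y + qK x * qRe y)"

instance
  by standard
    (simp_all add: quat_eq_iff zero_quat_def one_quat_def plus_quat_def times_quat_def
      scaleR_quat_def algebra_simps)

end

lemma quat_sel_simps [simp]:
  "qRe 0 = 0" "qI 0 = 0" "qJ 0 = 0" "qK 0 = 0"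
  "qRe 1 = 1" "qI 1 = 0" "qJ 1 = 0" "qK 1 = 0"
  "qRe (x + y) = qRe x + qRe y" "qI (x + y) = qI x + qI y"
  "qJ (x + y) = qJ x + qJ y" "qK (x + y) = qK x + qK y"
  "qRe (x - y) = qRe x - qRe y" "qI (x - y) = qI x - qI y"
  "qJ (x - y) = qJ x - qJ y" "qK (x - y) = qK x - qK y"
  "qRe (- x) = - qRe x" "qI (- x) = - qI x" "qJ (- x) = - qJ x" "qK (- x) = - qK x"
  "qRe (r *\<^sub>R x) = r * qRe x" "qI (r *\<^sub>R x) = r * qI x"
  "qJ (r *\<^sub>R x) = r * qJ x" "qK (r *\<^sub>R x) = r * qK x"
  by (simp_all add: zero_quat_def one_quat_def plus_quat_def minus_quat_def uminus_quat_def
      scaleR_quat_def)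

lemma quat_sel_mult:
  "qRe (x * y) = qRe x * qRe y - qI x * qI y - qJ x * qJ y - qK x * qK y"
  "qI (x * y) = qRe x * qI y + qI x * qRe y + qJ x * qK y - qK x * qJ y"
  "qJ (x * y) = qRe x * qJ y - qI x * qK y + qJ x * qRe y + qK x * qI y"
  "qK (x * y) = qRe x * qK y + qI x * qJ y - qJ x * qI y + qK x * qRe y"
  by (simp_all add: times_quat_def)

instantiation quat :: real_inner
begin

definition "x \<bullet> y = qRe x * qRe y + qI x * qI y + qJ x * qJ y + qK x * qK y"
definition "norm (x :: quat) = sqrt (x \<bullet> x)"
definition "sgn (x :: quat) = x /\<^sub>R norm x"
definition "dist (x :: quat) y = norm (x - y)"
definition "(uniformity :: (quat \<times> quat) filter) = (INF e\<in>{0<..}. principal {(x, y). dist x y < e})"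
definition "open (U :: quat set) \<longleftrightarrow>
  (\<forall>x\<in>U. eventually (\<lambda>(x', y). x' = x \<longrightarrow> y \<in> U) uniformity)"

instance
proof
  fix x y z :: quat and r :: real
  show "x \<bullet> y = y \<bullet> x" "(x + y) \<bullet> z = x \<bullet> z + y \<bullet> z" "(r *\<^sub>R x) \<bullet> y = r * (x \<bullet> y)"
    by (simp_all add: inner_quat_def algebra_simps)
  show "0 \<le> x \<bullet> x"
    by (simp add: inner_quat_def)
  show "x \<bullet> x = 0 \<longleftrightarrow> x = 0"
    by (auto simp: inner_quat_def quat_eq_iff add_nonneg_eq_0_iff)
qed (rule norm_quat_def sgn_quat_def dist_quat_def uniformity_quat_def open_quat_def)+

end

instantiation quat :: inverse
begin

definition "inverse (x :: quat) = (1 / (x \<bullet> x)) *\<^sub>R Quat (qRe x) (- qI x) (- qJ x) (- qK x)"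
definition "divide (x :: quat) y = x * inverse y"

instance ..

end

instance quat :: real_normed_div_algebra
proof
  fix x y :: quat
  show "inverse x * x = 1" if "x \<noteq> 0"
  proof -
    have "x \<bullet> x \<noteq> 0" using that by simp
    then show ?thesis
      by (simp add: quat_eq_iff inverse_quat_def quat_sel_mult field_simps) (simp add: inner_quat_def)
  qed
  show "x * inverse x = 1" if "x \<noteq> 0"
  proof -
    have "x \<bullet> x \<noteq> 0" using that by simp
    then show ?thesis
      by (simp add: quat_eq_iff inverse_quat_def quat_sel_mult field_simps) (simp add: inner_quat_def)
  qed
  show "inverse (0 :: quat) = 0"
    by (simp add: quat_eq_iff inverse_quat_def)
  show "x / y = x * inverse y"
    by (rule divide_quat_def)
  have "(x * y) \<bullet> (x * y) = (x \<bullet> x) * (y \<bullet> y)"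
    by (simp add: inner_quat_def quat_sel_mult algebra_simps)
  then show "norm (x * y) = norm x * norm y"
    by (simp add: norm_quat_def real_sqrt_mult)
qed


section \<open>Functions as vectors\<close>

instantiation "fun" :: (type, real_vector) real_vector
begin

definition "r *\<^sub>R f = (\<lambda>x. r *\<^sub>R f x)"

instance
  by standard (simp_all add: scaleR_fun_def fun_eq_iff algebra_simps)

end

type_synonym qfun = "quat \<Rightarrow> quat"

definition rscale :: "qfun \<Rightarrow> quat \<Rightarrow> qfun" where
  "rscale f \<alpha> = (\<lambda>x. f x * \<alpha>)"

text \<open>The locale \<open>module\<close> requires commutative scalars, so the notions for right
  quaternionic vector spaces are set up here, following \<open>span_explicit\<close>.\<close>

definition rspan :: "qfun set \<Rightarrow> qfun set" where
  "rspan S = {\<Sum>f\<in>T. rscale f (\<alpha> f) | T \<alpha>. finite T \<and> T \<subseteq> S}"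

definition rindependent :: "nat \<Rightarrow> (nat \<Rightarrow> qfun) \<Rightarrow> bool" where
  "rindependent k b \<longleftrightarrow>
     (\<forall>\<alpha>. (\<Sum>i<k. rscale (b i) (\<alpha> i)) = 0 \<longrightarrow> (\<forall>i<k. \<alpha> i = 0))"

definition monomial :: "nat \<Rightarrow> (nat \<Rightarrow> quat) \<Rightarrow> qfun" where
  "monomial r \<alpha> = (\<lambda>q. \<alpha> 0 * prod_list (map (\<lambda>i. q * \<alpha> i) [1..<Suc r]))"

definition Hom :: "nat \<Rightarrow> qfun set" where
  "Hom r = rspan (range (monomial r))"

definition Pol :: "nat \<Rightarrow> qfun set" where
  "Pol n = rspan (\<Union>r\<le>n. Hom r)"


section \<open>Topologies on spaces and Grassmannians of functions\<close>

text \<open>The coarsest topology on \<open>V\<close> making every real linear functional continuous. If \<open>V\<close>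
  is a finite-dimensional real subspace, this is its usual topology, as \<open>homeomorphic_map_basis\<close>
  shows. Functionals on \<open>V\<close> extend to the whole type, so quantifying over the latter is no
  restriction.\<close>

definition findim_topology :: "'a::real_vector set \<Rightarrow> 'a topology" where
  "findim_topology V =
     topology_generated_by {{v \<in> V. \<phi> v \<in> U} | \<phi> U. linear \<phi> \<and> open (U :: real set)}"

lemma topspace_findim_topology [simp]: "topspace (findim_topology V) = V"
proof -
  have "{v \<in> V. (\<lambda>_. 0 :: real) v \<in> UNIV} \<in> {{v \<in> V. \<phi> v \<in> U} | \<phi> U. linear \<phi> \<and> open (U :: real set)}"
    using module_hom_zero open_UNIV by blast
  then show ?thesis
    unfolding findim_topology_def topology_generated_by_topspace by auto
qed

lemma continuous_map_into_findim_topology: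
  "continuous_map X (findim_topology V) f \<longleftrightarrow>
     f ` topspace X \<subseteq> V \<and> (\<forall>\<phi>. linear \<phi> \<longrightarrow> continuous_map X euclideanreal (\<lambda>x. \<phi> (f x)))"
  (is "?L \<longleftrightarrow> ?R")
proof
  assume L: ?L
  have sub: "f ` topspace X \<subseteq> V"
    using continuous_map_image_subset_topspace[OF L] by simp
  have "continuous_map X euclideanreal (\<lambda>x. \<phi> (f x))" if "linear \<phi>" for \<phi>
    unfolding continuous_map_def
  proof (intro conjI allI impI)
    fix U :: "real set" assume "openin euclideanreal U"
    then have "openin (findim_topology V) {v \<in> V. \<phi> v \<in> U}"
      unfolding findim_topology_def using that by (intro topology_generated_by_Basis) auto
    then have "openin X {x \<in> topspace X. f x \<in> {v \<in> V. \<phi> v \<in> U}}"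
      by (rule openin_continuous_map_preimage[OF L])
    moreover have "{x \<in> topspace X. f x \<in> {v \<in> V. \<phi> v \<in> U}} = {x \<in> topspace X. \<phi> (f x) \<in> U}"
      using sub by auto
    ultimately show "openin X {x \<in> topspace X. \<phi> (f x) \<in> U}" by simp
  qed auto
  with sub show ?R by blast
next
  assume R: ?R
  show ?L
    unfolding findim_topology_def
  proof (rule continuous_on_generated_topo)
    fix W assume "W \<in> {{v \<in> V. \<phi> v \<in> U} | \<phi> U. linear \<phi> \<and> open (U :: real set)}"
    then obtain \<phi> and U :: "real set" where W: "W = {v \<in> V. \<phi> v \<in> U}" "linear \<phi>" "open U"
      by blast
    then have "openin X {x \<in> topspace X. \<phi> (f x) \<in> U}"
      using R by (intro openin_continuous_map_preimage[where Y = euclideanreal]) auto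
    moreover have "f -` W \<inter> topspace X = {x \<in> topspace X. \<phi> (f x) \<in> U}"
      using R W by auto
    ultimately show "openin X (f -` W \<inter> topspace X)" by simp
  next
    show "f ` topspace X \<subseteq> \<Union> {{v \<in> V. \<phi> v \<in> U} | \<phi> U. linear \<phi> \<and> open (U :: real set)}"
      using R topspace_findim_topology[of V]
      unfolding findim_topology_def topology_generated_by_topspace by auto
  qed
qed

lemma homeomorphic_map_basis:
  fixes b :: "nat \<Rightarrow> 'a::real_vector"
  assumes "independent (b ` {..<m})" "inj_on b {..<m}"
  shows "homeomorphic_map (product_topology (\<lambda>_. euclideanreal) {..<m})
    (findim_topology (span (b ` {..<m}))) (\<lambda>c. \<Sum>i<m. c i *\<^sub>R b i)"
proof -
  define V where "V = span (b ` {..<m})"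
  define coord where "coord = (\<lambda>v. \<lambda>i\<in>{..<m}. representation (b ` {..<m}) v (b i))"
  have ext: "\<exists>\<phi> :: 'a \<Rightarrow> real. linear \<phi> \<and> (\<forall>v\<in>V. \<phi> v = representation (b ` {..<m}) v (b i))"
    if i: "i < m" for i
  proof -
    obtain \<phi> :: "'a \<Rightarrow> real" where \<phi>: "linear \<phi>" "\<forall>x\<in>b ` {..<m}. \<phi> x = (if x = b i then 1 else 0)"
      using linear_independent_extend[OF assms(1), of "\<lambda>x. if x = b i then 1 else (0::real)"] by blast
    have "\<phi> v = representation (b ` {..<m}) v (b i)" if v: "v \<in> V" for v
    proof -
      have "(\<Sum>x\<in>b ` {..<m}. representation (b ` {..<m}) v x *\<^sub>R x) = v"
        using real_vector.sum_representation_eq[OF assms(1), of v "b ` {..<m}"] v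
        by (simp add: V_def)
      then have "\<phi> v = \<phi> (\<Sum>x\<in>b ` {..<m}. representation (b ` {..<m}) v x *\<^sub>R x)"
        by simp
      also have "\<dots> = (\<Sum>x\<in>b ` {..<m}. representation (b ` {..<m}) v x * \<phi> x)"
        using \<phi>(1) by (simp add: linear_sum linear_scale)
      also have "\<dots> = (\<Sum>x\<in>b ` {..<m}. if x = b i then representation (b ` {..<m}) v x else 0)"
      proof (intro sum.cong refl)
        fix x assume "x \<in> b ` {..<m}"
        then show "representation (b ` {..<m}) v x * \<phi> x
            = (if x = b i then representation (b ` {..<m}) v x else 0)"
          using bspec[OF \<phi>(2)] by simp
      qed
      finally show ?thesis
        using i by (simp add: sum.delta)
    qed
    with \<phi>(1) show ?thesis by blast
  qed
  have "homeomorphic_maps (product_topology (\<lambda>_. euclideanreal) {..<m}) (findim_topology V)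
      (\<lambda>c. \<Sum>i<m. c i *\<^sub>R b i) coord"
    unfolding homeomorphic_maps_def
  proof (intro conjI ballI)
    have "continuous_map (product_topology (\<lambda>_. euclideanreal) {..<m}) euclideanreal
        (\<lambda>c. \<phi> (\<Sum>i<m. c i *\<^sub>R b i))" if "linear \<phi>" for \<phi>
    proof -
      have "(\<lambda>c. \<phi> (\<Sum>i<m. c i *\<^sub>R b i)) = (\<lambda>c. \<Sum>i<m. c i * \<phi> (b i))"
        using that by (simp add: linear_sum linear_scale)
      then show ?thesis
        by (auto intro!: continuous_map_sum continuous_map_real_mult
            continuous_map_product_projection)
    qed
    moreover have "(\<Sum>i<m. c i *\<^sub>R b i) \<in> V" for c
      unfolding V_def by (intro span_sum span_scale) (simp add: span_base)
    ultimately show "continuous_map (product_topology (\<lambda>_. euclideanreal) {..<m}) (findim_topology V)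
        (\<lambda>c. \<Sum>i<m. c i *\<^sub>R b i)"
      unfolding continuous_map_into_findim_topology by blast
  next
    have "continuous_map (findim_topology V) euclideanreal (\<lambda>v. coord v i)" if "i < m" for i
    proof -
      obtain \<phi> :: "'a \<Rightarrow> real" where "linear \<phi>" "\<forall>v\<in>V. \<phi> v = representation (b ` {..<m}) v (b i)"
        using ext[OF \<open>i < m\<close>] by blast
      moreover from this have "continuous_map (findim_topology V) euclideanreal \<phi>"
        using continuous_map_into_findim_topology[of "findim_topology V" V "\<lambda>v. v"] by simp
      ultimately show ?thesis
        by (elim continuous_map_eq) (use that in \<open>auto simp: coord_def\<close>)
    qed
    then show "continuous_map (findim_topology V) (product_topology (\<lambda>_. euclideanreal) {..<m}) coord"
      by (auto simp: continuous_map_componentwise coord_def)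
  next
    fix c assume c: "c \<in> topspace (product_topology (\<lambda>_. euclideanreal) {..<m})"
    have "representation (b ` {..<m}) (\<Sum>i<m. c i *\<^sub>R b i) (b j) = c j" if "j < m" for j
    proof -
      have span: "b i \<in> span (b ` {..<m})" if "i < m" for i
        using that by (intro span_base) auto
      have "representation (b ` {..<m}) (\<Sum>i<m. c i *\<^sub>R b i)
          = (\<lambda>x. \<Sum>i<m. representation (b ` {..<m}) (c i *\<^sub>R b i) x)"
        by (intro real_vector.representation_sum assms(1) span_scale span) auto
      then have "representation (b ` {..<m}) (\<Sum>i<m. c i *\<^sub>R b i) (b j)
          = (\<Sum>i<m. representation (b ` {..<m}) (c i *\<^sub>R b i) (b j))"
        by simp
      also have "\<dots> = (\<Sum>i<m. c i * representation (b ` {..<m}) (b i) (b j))"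
        by (intro sum.cong refl) (simp add: real_vector.representation_scale[OF assms(1)] span)
      also have "\<dots> = (\<Sum>i<m. if i = j then c i else 0)"
        using assms that
        by (intro sum.cong) (auto simp: real_vector.representation_basis inj_on_eq_iff)
      finally show ?thesis using that by simp
    qed
    then show "coord (\<Sum>i<m. c i *\<^sub>R b i) = c"
      using c by (auto simp: coord_def fun_eq_iff PiE_def extensional_def)
  next
    fix v assume "v \<in> topspace (findim_topology V)"
    then have "v \<in> V" by simp
    then have "(\<Sum>x\<in>b ` {..<m}. representation (b ` {..<m}) v x *\<^sub>R x) = v"
      using real_vector.sum_representation_eq[OF assms(1), of v "b ` {..<m}"] by (simp add: V_def)
    then show "(\<Sum>i<m. coord v i *\<^sub>R b i) = v"
      using assms(2) by (simp add: coord_def sum.reindex)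
  qed
  then show ?thesis
    unfolding V_def by (rule homeomorphic_maps_imp_map)
qed

definition frame_topology :: "nat \<Rightarrow> qfun set \<Rightarrow> (nat \<Rightarrow> qfun) topology" where
  "frame_topology k V =
     subtopology (product_topology (\<lambda>_. findim_topology V) {..<k}) {b. rindependent k b}"

definition frame_span :: "nat \<Rightarrow> (nat \<Rightarrow> qfun) \<Rightarrow> qfun set" where
  "frame_span k b = rspan (b ` {..<k})"

text \<open>The points are the \<open>k\<close>-dimensional right subspaces of \<open>V\<close>; the topology is the quotient
  topology with respect to the map sending a \<open>k\<close>-frame to its span.\<close>

definition grassmannian :: "nat \<Rightarrow> qfun set \<Rightarrow> qfun set set" where
  "grassmannian k V = frame_span k ` topspace (frame_topology k V)"

definition grassmannian_topology :: "nat \<Rightarrow> qfun set \<Rightarrow> qfun set topology" where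
  "grassmannian_topology k V = topology (\<lambda>\<U>. \<U> \<subseteq> grassmannian k V \<and>
     openin (frame_topology k V) {b \<in> topspace (frame_topology k V). frame_span k b \<in> \<U>})"

lemma openin_grassmannian_topology:
  "openin (grassmannian_topology k V) \<U> \<longleftrightarrow> \<U> \<subseteq> grassmannian k V \<and>
     openin (frame_topology k V) {b \<in> topspace (frame_topology k V). frame_span k b \<in> \<U>}"
proof -
  let ?X = "frame_topology k V"
  let ?pre = "\<lambda>\<U>. {b \<in> topspace ?X. frame_span k b \<in> \<U>}"
  have "istopology (\<lambda>\<U>. \<U> \<subseteq> grassmannian k V \<and> openin ?X (?pre \<U>))"
    unfolding istopology_def
  proof (intro conjI allI impI)
    fix S T assume "S \<subseteq> grassmannian k V \<and> openin ?X (?pre S)"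
      "T \<subseteq> grassmannian k V \<and> openin ?X (?pre T)"
    moreover have "?pre (S \<inter> T) = ?pre S \<inter> ?pre T" by auto
    ultimately show "S \<inter> T \<subseteq> grassmannian k V" "openin ?X (?pre (S \<inter> T))" by auto
  next
    fix \<K> assume \<K>: "\<forall>K\<in>\<K>. K \<subseteq> grassmannian k V \<and> openin ?X (?pre K)"
    then show "\<Union>\<K> \<subseteq> grassmannian k V" by auto
    have "?pre (\<Union>\<K>) = \<Union> (?pre ` \<K>)" by auto
    also have "openin ?X \<dots>" using \<K> by (intro openin_Union) auto
    finally show "openin ?X (?pre (\<Union>\<K>))" .
  qed
  then show ?thesis
    unfolding grassmannian_topology_def by (simp add: topology_inverse')
qed

lemma topspace_grassmannian_topology [simp]:
  "topspace (grassmannian_topology k V) = grassmannian k V"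
proof -
  have "openin (grassmannian_topology k V) (grassmannian k V)"
  proof -
    have "{b \<in> topspace (frame_topology k V). frame_span k b \<in> grassmannian k V}
        = topspace (frame_topology k V)"
      by (auto simp: grassmannian_def)
    then show ?thesis by (simp add: openin_grassmannian_topology)
  qed
  then show ?thesis
    by (meson openin_grassmannian_topology openin_subset openin_topspace subset_antisym)
qed


section \<open>The interpolation operators\<close>

definition sym_poly :: "quat list \<Rightarrow> qfun" where
  "sym_poly ys x = (1 / fact (length ys)) *\<^sub>R
     (\<Sum>\<sigma> | \<sigma> permutes {..<length ys}. prod_list (map (\<lambda>i. x - ys ! \<sigma> i) [0..<length ys]))"

definition others :: "nat \<Rightarrow> nat \<Rightarrow> nat list" where
  "others n j = filter (\<lambda>k. k \<noteq> j) [0..<Suc n]"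

text \<open>A set of \<open>n + 1\<close> points is given by an enumeration \<open>x 0, \<dots>, x n\<close>; values of \<open>x\<close> beyond \<open>n\<close>
  are irrelevant.\<close>

definition node_poly :: "nat \<Rightarrow> (nat \<Rightarrow> quat) \<Rightarrow> nat \<Rightarrow> qfun" where
  "node_poly n x j = sym_poly (map x (others n j))"

datatype lagrange_choice = Choice_I | Choice_II

fun ell :: "lagrange_choice \<Rightarrow> nat \<Rightarrow> (nat \<Rightarrow> quat) \<Rightarrow> nat \<Rightarrow> qfun" where
  "ell Choice_I n x j t = node_poly n x j t * inverse (node_poly n x j (x j))"
| "ell Choice_II n x j t = (1 / fact n) *\<^sub>R
     (\<Sum>\<sigma> | \<sigma> permutes {..n} \<and> \<sigma> j = j.
        prod_list (map (\<lambda>k. (t - x (\<sigma> k)) * inverse (x j - x (\<sigma> k))) (others n j)))"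

fun nodes :: "lagrange_choice \<Rightarrow> nat \<Rightarrow> (nat \<Rightarrow> quat) set" where
  "nodes Choice_I n = {x. inj_on x {..n} \<and> (\<forall>j\<le>n. node_poly n x j (x j) \<noteq> 0)}"
| "nodes Choice_II n = {x. inj_on x {..n}}"

definition nodes_topology :: "lagrange_choice \<Rightarrow> nat \<Rightarrow> (nat \<Rightarrow> quat) topology" where
  "nodes_topology c n = subtopology (product_topology (\<lambda>_. euclidean) {..n}) (nodes c n)"

definition lagrange_op :: "lagrange_choice \<Rightarrow> nat \<Rightarrow> (nat \<Rightarrow> quat) \<Rightarrow> qfun \<Rightarrow> qfun" where
  "lagrange_op c n x f = (\<lambda>t. \<Sum>j\<le>n. ell c n x j t * f (x j))"

end

theory Submission
  imports Defs "HOL-Combinatorics.Multiset_Permutations"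
begin

text \<open>
  Once the averages over permutations are read as averages over the orderings of a finite set, each
  \<open>\<ell>\<^sub>j\<close> is seen to depend only on the set \<open>A\<close> of all points and on the distinguished point
  \<open>a = x\<^sub>j \<in> A\<close> (\<open>ell_eq_fundamental\<close>), so \<open>L f = (\<Sum>a\<in>A. fundamental c A a \<cdot> f a)\<close>. This is
  independent of the ordering. Every factor depends only on differences \<open>t - z\<close> and \<open>a - z\<close>, whence
  translation invariance (\<open>fundamental_translate\<close>). At a point \<open>b \<noteq> a\<close> of \<open>A\<close> every ordered product
  contains the factor \<open>b - b = 0\<close>, so the average vanishes without any appeal to commutativity, while
  the normalisation makes the value at \<open>a\<close> equal to 1 (\<open>fundamental_other\<close>, \<open>fundamental_self\<close>).
  Interpolation and the independence of the \<open>\<ell>\<^sub>j\<close> follow.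

  Continuity into \<open>Pol n\<close> has to be tested against arbitrary real linear functionals \<open>\<phi>\<close>. No
  coordinates on \<open>Pol n\<close> are needed: if a family \<open>F\<^sub>p\<close> is continuous and \<open>u\<^sub>p\<close> is a continuous
  quaternion, then expanding \<open>u\<^sub>p\<close> over the real basis \<open>e\<close> of the quaternions writes
  \<open>\<phi> (u\<^sub>p F\<^sub>p)\<close> as a sum of continuous reals times \<open>\<phi> (e F\<^sub>p)\<close>, and \<open>\<phi> \<circ> (e \<cdot> _)\<close> is again a linear
  functional. The same works for multiplication from the right, and multiplication by the variable is
  linear from \<open>Pol n\<close> to \<open>Pol (n + 1)\<close>. Hence products of factors \<open>(t - u\<^sub>p) v\<^sub>p\<close> are continuous
  families, and with them the \<open>\<ell>\<^sub>j\<close> (\<open>continuous_map_ell\<close>).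

  Finally the range of \<open>L\<close> is the right span of the frame \<open>(\<ell>\<^sub>0, \<dots>, \<ell>\<^sub>n)\<close>, so it is the image of a
  continuous family of frames under the quotient map that defines the topology of the Grassmannian.
\<close>

section \<open>Symmetrised products over a finite set\<close>

definition sym_prod :: "('a \<Rightarrow> 'b::semiring_1) \<Rightarrow> 'a set \<Rightarrow> 'b" where
  "sym_prod g B = (\<Sum>zs\<in>permutations_of_set B. prod_list (map g zs))"

text \<open>Permuting the positions of a list of distinct entries runs exactly once through the orderings of
  its set of entries; choice (I) averages in this way.\<close>

lemma sum_permutes_positions:
  assumes "distinct ys"
  shows "(\<Sum>\<sigma> | \<sigma> permutes {..<length ys}. prod_list (map (\<lambda>i. g (ys ! \<sigma> i)) [0..<length ys]))
    = sym_prod g (set ys)"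
proof -
  let ?P = "{\<sigma>. \<sigma> permutes {..<length ys}}"
  have inj: "inj_on (\<lambda>\<sigma>. permute_list \<sigma> ys) ?P"
  proof (rule inj_onI, rule ext)
    fix \<sigma> \<tau> i
    assume s: "\<sigma> \<in> ?P" and t: "\<tau> \<in> ?P" and eq: "permute_list \<sigma> ys = permute_list \<tau> ys"
    show "\<sigma> i = \<tau> i"
    proof (cases "i < length ys")
      case True
      then have "ys ! \<sigma> i = ys ! \<tau> i"
        using s t arg_cong[OF eq, of "\<lambda>zs. zs ! i"] by (simp add: permute_list_nth)
      moreover have "\<sigma> i < length ys" "\<tau> i < length ys"
        using s t True permutes_in_image by fastforce+
      ultimately show ?thesis using assms by (simp add: nth_eq_iff_index_eq)
    next
      case False
      then show ?thesis using s t by (simp add: permutes_def)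
    qed
  qed
  have sub: "(\<lambda>\<sigma>. permute_list \<sigma> ys) ` ?P \<subseteq> permutations_of_set (set ys)"
    using assms by (auto intro!: permutations_of_setI)
  \<comment> \<open>Both sides have \<open>(length ys)!\<close> elements, which spares a proof of surjectivity.\<close>
  have "card ((\<lambda>\<sigma>. permute_list \<sigma> ys) ` ?P) = card (permutations_of_set (set ys))"
    using assms by (simp add: card_image[OF inj] card_permutations[OF refl] distinct_card)
  then have "bij_betw (\<lambda>\<sigma>. permute_list \<sigma> ys) ?P (permutations_of_set (set ys))"
    using inj sub by (simp add: bij_betw_def card_subset_eq)
  from sum.reindex_bij_betw[OF this, of "\<lambda>zs. prod_list (map g zs)"] show ?thesis
    by (simp add: sym_prod_def permute_list_def o_def)
qed

text \<open>Choice (II) permutes the indices themselves rather than their positions; this again runs once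
  through the orderings of the index set.\<close>

lemma sum_permutes_elements:
  assumes "distinct ks"
  shows "(\<Sum>\<sigma> | \<sigma> permutes set ks. prod_list (map (\<lambda>k. g (\<sigma> k)) ks)) = sym_prod g (set ks)"
proof -
  let ?P = "{\<sigma>. \<sigma> permutes set ks}"
  have inj: "inj_on (\<lambda>\<sigma>. map \<sigma> ks) ?P"
  proof (rule inj_onI, rule ext)
    fix \<sigma> \<tau> k
    assume "\<sigma> \<in> ?P" "\<tau> \<in> ?P" "map \<sigma> ks = map \<tau> ks"
    then show "\<sigma> k = \<tau> k"
      by (cases "k \<in> set ks") (simp_all add: permutes_def)
  qed
  have sub: "(\<lambda>\<sigma>. map \<sigma> ks) ` ?P \<subseteq> permutations_of_set (set ks)"
    using assms by (auto intro!: permutations_of_setI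
        simp: permutes_image distinct_map permutes_inj_on simp del: image_set simp flip: image_set)
  have "card ((\<lambda>\<sigma>. map \<sigma> ks) ` ?P) = card (permutations_of_set (set ks))"
    by (simp add: card_image[OF inj] card_permutations[OF refl])
  then have "bij_betw (\<lambda>\<sigma>. map \<sigma> ks) ?P (permutations_of_set (set ks))"
    using inj sub by (simp add: bij_betw_def card_subset_eq)
  from sum.reindex_bij_betw[OF this, of "\<lambda>zs. prod_list (map g zs)"] show ?thesis
    by (simp add: sym_prod_def o_def)
qed

lemma sym_prod_image:
  assumes "inj_on f B"
  shows "sym_prod g (f ` B) = sym_prod (g \<circ> f) B"
proof -
  have "inj_on (map f) (permutations_of_set B)"
    using assms by (auto intro!: inj_on_mapI inj_on_subset[of f B] dest: permutations_of_setD)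
  then show ?thesis
    by (simp add: sym_prod_def permutations_of_set_image_inj[OF assms] sum.reindex)
qed

lemma sym_prod_cong:
  assumes "\<And>z. z \<in> B \<Longrightarrow> g z = h z"
  shows "sym_prod g B = sym_prod h B"
  unfolding sym_prod_def
  by (intro sum.cong refl arg_cong[where f = prod_list] map_cong)
    (use assms in \<open>auto dest: permutations_of_setD\<close>)

lemma sym_prod_eq_0:
  fixes g :: "'a \<Rightarrow> 'b::{semiring_1, semiring_no_zero_divisors}"
  assumes "b \<in> B" "g b = 0"
  shows "sym_prod g B = 0"
  unfolding sym_prod_def
proof (intro sum.neutral ballI)
  fix zs assume "zs \<in> permutations_of_set B"
  then have "b \<in> set zs" using assms(1) by (simp add: permutations_of_setD(1))
  then show "prod_list (map g zs) = 0"
    using assms(2) by (force simp: prod_list_zero_iff)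
qed

lemma sym_prod_const_1: "finite B \<Longrightarrow> sym_prod (\<lambda>_. 1) B = of_nat (fact (card B))"
  by (simp add: sym_prod_def map_replicate_const)


section \<open>The fundamental functions of a set of points\<close>

text \<open>The factor \<open>1 / n!\<close> of choice (I) cancels between the polynomial and the inverse of its value.\<close>

fun fundamental :: "lagrange_choice \<Rightarrow> quat set \<Rightarrow> quat \<Rightarrow> qfun" where
  "fundamental Choice_I A a t =
     sym_prod (\<lambda>z. t - z) (A - {a}) * inverse (sym_prod (\<lambda>z. a - z) (A - {a}))"
| "fundamental Choice_II A a t =
     (1 / fact (card (A - {a}))) *\<^sub>R sym_prod (\<lambda>z. (t - z) * inverse (a - z)) (A - {a})"

fun admissible :: "lagrange_choice \<Rightarrow> quat set \<Rightarrow> bool" where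
  "admissible Choice_I A \<longleftrightarrow> (\<forall>a\<in>A. sym_prod (\<lambda>z. a - z) (A - {a}) \<noteq> 0)"
| "admissible Choice_II A \<longleftrightarrow> True"

lemma fundamental_self:
  assumes "finite A" "a \<in> A" "admissible c A"
  shows "fundamental c A a a = 1"
proof (cases c)
  case Choice_I
  then show ?thesis using assms by simp
next
  case Choice_II
  have "sym_prod (\<lambda>z. (a - z) * inverse (a - z)) (A - {a}) = sym_prod (\<lambda>_. 1) (A - {a})"
    by (rule sym_prod_cong) (auto intro!: right_inverse)
  also have "\<dots> = fact (card (A - {a}))"
    using assms by (simp add: sym_prod_const_1)
  finally have "fundamental c A a a = (1 / fact (card (A - {a}))) *\<^sub>R fact (card (A - {a}))"
    using Choice_II by simp
  also have "\<dots> = (1 / fact (card (A - {a}))) *\<^sub>R of_real (fact (card (A - {a})))"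
    by simp
  also have "\<dots> = 1"
    by (simp only: scaleR_conv_of_real flip: of_real_mult) simp
  finally show ?thesis .
qed

lemma fundamental_other:
  assumes "b \<in> A" "b \<noteq> a"
  shows "fundamental c A a b = 0"
  using assms by (cases c) (simp_all add: sym_prod_eq_0[of b])

lemma image_add_Diff: "(\<lambda>z. z + d) ` A - {a + d} = (\<lambda>z. z + d) ` (A - {a})" for d :: quat
  by auto

lemma fundamental_translate:
  "fundamental c ((\<lambda>z. z + d) ` A) (a + d) t = fundamental c A a (t - d)"
proof -
  have inj: "inj_on (\<lambda>z. z + d) B" for B by simp
  have shift: "t - (z + d) = t - d - z" for z
    by simp
  show ?thesis
    by (cases c) (simp_all add: image_add_Diff sym_prod_image[OF inj] card_image[OF inj] o_def
 shift)
qed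

lemma admissible_translate: "admissible c ((\<lambda>z. z + d) ` A) \<longleftrightarrow> admissible c A"
proof -
  have inj: "inj_on (\<lambda>z. z + d) B" for B by simp
  show ?thesis
    by (cases c) (simp_all add: image_add_Diff sym_prod_image[OF inj] o_def)
qed

lemma distinct_others: "distinct (others n j)"
  by (simp add: others_def)

lemma set_others: "set (others n j) = {..n} - {j}"
  by (auto simp: others_def)

lemma length_others: "j \<le> n \<Longrightarrow> length (others n j) = n"
  using distinct_card[OF distinct_others, of n j] by (simp add: set_others)

lemma image_Diff_inj:
  assumes "inj_on x {..n}" "j \<le> n"
  shows "x ` ({..n} - {j}) = x ` {..n} - {x j}"
  using assms by (auto simp: inj_on_def)

lemma node_poly_eq_sym_prod:
  assumes "inj_on x {..n}" "j \<le> n"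
  shows "node_poly n x j t = (1 / fact n) *\<^sub>R sym_prod (\<lambda>z. t - z) (x ` {..n} - {x j})"
proof -
  have "inj_on x ({..n} - {j})"
    using assms(1) by (rule inj_on_subset) auto
  then have "distinct (map x (others n j))"
    by (simp add: distinct_map distinct_others set_others)
  from sum_permutes_positions[OF this, of "\<lambda>z. t - z"] show ?thesis
    using assms
    by (simp add: node_poly_def sym_poly_def length_others set_others image_Diff_inj del: map_map)
qed

lemma ell_eq_fundamental:
  assumes "inj_on x {..n}" "j \<le> n"
  shows "ell c n x j = fundamental c (x ` {..n}) (x j)"
proof (rule ext, cases c)
  fix t
  case Choice_I
  then show "ell c n x j t = fundamental c (x ` {..n}) (x j) t"
    using assms by (simp add: node_poly_eq_sym_prod inverse_scaleR_distrib)
next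
  fix t
  case Choice_II
  have perms: "{\<sigma>. \<sigma> permutes {..n} \<and> \<sigma> j = j} = {\<sigma>. \<sigma> permutes set (others n j)}"
    by (auto simp: set_others intro: permutes_superset permutes_subset permutes_not_in)
  have inj: "inj_on x ({..n} - {j})"
    using assms(1) by (rule inj_on_subset) auto
  have "card (x ` {..n} - {x j}) = n"
    using assms by (simp add: card_image inj flip: image_Diff_inj)
  then show "ell c n x j t = fundamental c (x ` {..n}) (x j) t"
    using assms inj Choice_II
    using sum_permutes_elements[OF distinct_others, of "\<lambda>k. (t - x k) * inverse (x j - x k)" n j]
    by (simp add: perms set_others sym_prod_image o_def flip: image_Diff_inj)
qed

lemma nodes_iff: "x \<in> nodes c n \<longleftrightarrow> inj_on x {..n} \<and> admissible c (x ` {..n})"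
  by (cases c) (auto simp: node_poly_eq_sym_prod)

lemma lagrange_op_eq_sum_set:
  assumes "inj_on x {..n}"
  shows "lagrange_op c n x f t = (\<Sum>a\<in>x ` {..n}. fundamental c (x ` {..n}) a t * f a)"
  using assms by (simp add: lagrange_op_def ell_eq_fundamental sum.reindex)

lemma ell_at_node:
  assumes "x \<in> nodes c n" "i \<le> n" "j \<le> n"
  shows "ell c n x j (x i) = (if i = j then 1 else 0)"
  using assms fundamental_self[of "x ` {..n}" "x j" c] fundamental_other[of "x i" "x ` {..n}" "x j" c]
  by (auto simp: nodes_iff ell_eq_fundamental inj_on_eq_iff)

lemma lagrange_op_interpolates:
  assumes "x \<in> nodes c n" "i \<le> n"
  shows "lagrange_op c n x f (x i) = f (x i)"
proof -
  have "lagrange_op c n x f (x i) = (\<Sum>j\<le>n. if i = j then f (x j) else 0)"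
    unfolding lagrange_op_def by (intro sum.cong refl) (simp add: ell_at_node assms)
  then show ?thesis using assms(2) by simp
qed


section \<open>Right quaternionic subspaces of functions\<close>

lemma sum_fun_apply: "(\<Sum>i\<in>I. F i) t = (\<Sum>i\<in>I. F i t)"
  by (induction I rule: infinite_finite_induct) simp_all

definition right_subspace :: "qfun set \<Rightarrow> bool" where
  "right_subspace W \<longleftrightarrow>
     0 \<in> W \<and> (\<forall>f\<in>W. \<forall>g\<in>W. f + g \<in> W) \<and> (\<forall>f\<in>W. \<forall>\<alpha>. rscale f \<alpha> \<in> W)"

lemma right_subspace_sum:
  assumes "right_subspace W" "\<And>i. i \<in> I \<Longrightarrow> F i \<in> W"
  shows "(\<Sum>i\<in>I. F i) \<in> W"
  using assms by (induction I rule: infinite_finite_induct) (auto simp: right_subspace_def)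

lemma right_subspace_imp_subspace:
  assumes "right_subspace W"
  shows "subspace W"
proof (rule subspaceI)
  fix r :: real and f assume "f \<in> W"
  moreover have "r *\<^sub>R f = rscale f (of_real r)"
    by (simp add: fun_eq_iff scaleR_fun_def rscale_def of_real_def)
  ultimately show "r *\<^sub>R f \<in> W"
    using assms by (simp add: right_subspace_def)
qed (use assms in \<open>auto simp: right_subspace_def\<close>)

lemma rspan_minimal:
  assumes "right_subspace W" "S \<subseteq> W"
  shows "rspan S \<subseteq> W"
  unfolding rspan_def using assms
  by (auto intro!: right_subspace_sum) (auto simp: right_subspace_def)

lemma rspan_superset: "S \<subseteq> rspan S"
proof
  fix f assume "f \<in> S"
  then show "f \<in> rspan S"
    unfolding rspan_def
    by (intro CollectI exI[of _ "{f}"] exI[of _ "\<lambda>_. 1"]) (simp add: rscale_def)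
qed

lemma right_subspace_rspan: "right_subspace (rspan S)"
  unfolding right_subspace_def
proof (intro conjI ballI allI)
  show "0 \<in> rspan S"
    unfolding rspan_def by (intro CollectI exI[of _ "{}"]) simp
next
  fix f g assume "f \<in> rspan S" "g \<in> rspan S"
  then obtain T \<alpha> U \<beta> where
    f: "f = (\<Sum>h\<in>T. rscale h (\<alpha> h))" "finite T" "T \<subseteq> S" and
    g: "g = (\<Sum>h\<in>U. rscale h (\<beta> h))" "finite U" "U \<subseteq> S"
    unfolding rspan_def by blast
  let ?\<gamma> = "\<lambda>h. (if h \<in> T then \<alpha> h else 0) + (if h \<in> U then \<beta> h else 0)"
  have "(\<Sum>h\<in>T \<union> U. rscale h (?\<gamma> h)) =
      (\<Sum>h\<in>T \<union> U. if h \<in> T then rscale h (\<alpha> h) else 0) +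
      (\<Sum>h\<in>T \<union> U. if h \<in> U then rscale h (\<beta> h) else 0)"
    unfolding sum.distrib[symmetric]
    by (intro sum.cong refl) (auto simp: rscale_def fun_eq_iff distrib_left)
  also have "\<dots> = f + g"
    using f(2) g(2) unfolding f(1) g(1)
    by (intro arg_cong2[where f = plus] sum.mono_neutral_cong_right) auto
  finally show "f + g \<in> rspan S"
    unfolding rspan_def using f(2,3) g(2,3)
    by (intro CollectI exI[of _ "T \<union> U"] exI[of _ ?\<gamma>]) simp
next
  fix f \<beta> assume "f \<in> rspan S"
  then obtain T \<alpha> where f: "f = (\<Sum>h\<in>T. rscale h (\<alpha> h))" "finite T" "T \<subseteq> S"
    unfolding rspan_def by blast
  have "rscale f \<beta> = (\<Sum>h\<in>T. rscale h (\<alpha> h * \<beta>))"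
    unfolding f(1)
    by (simp add: rscale_def fun_eq_iff sum_fun_apply sum_distrib_right mult.assoc)
  then show "rscale f \<beta> \<in> rspan S"
    unfolding rspan_def using f(2,3) by (intro CollectI exI[of _ T] exI[of _ "\<lambda>h. \<alpha> h * \<beta>"]) simp
qed

lemma right_subspace_Pol: "right_subspace (Pol n)"
  by (simp add: Pol_def right_subspace_rspan)

lemma monomial_in_Pol: "r \<le> n \<Longrightarrow> monomial r \<alpha> \<in> Pol n"
  using rspan_superset[of "range (monomial r)"] rspan_superset[of "\<Union>r\<le>n. Hom r"]
  unfolding Pol_def Hom_def by blast

lemma Pol_minimal:
  assumes "right_subspace W" "\<And>r \<alpha>. r \<le> n \<Longrightarrow> monomial r \<alpha> \<in> W"
  shows "Pol n \<subseteq> W"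
  unfolding Pol_def Hom_def
  by (intro rspan_minimal UN_least assms(1)) (use assms(2) in auto)

lemma Pol_left_mult:
  assumes "f \<in> Pol n"
  shows "(\<lambda>t. \<beta> * f t) \<in> Pol n"
proof -
  have "right_subspace {f. (\<lambda>t. \<beta> * f t) \<in> Pol n}"
    using right_subspace_Pol[of n]
    by (auto simp: right_subspace_def rscale_def plus_fun_def zero_fun_def distrib_left
        simp flip: mult.assoc)
  moreover have "(\<lambda>t. \<beta> * monomial r \<alpha> t) = monomial r (\<alpha>(0 := \<beta> * \<alpha> 0))" for r \<alpha>
    by (auto simp: monomial_def fun_eq_iff mult.assoc intro!: arg_cong[where f = prod_list])
  ultimately have "Pol n \<subseteq> {f. (\<lambda>t. \<beta> * f t) \<in> Pol n}"
    by (intro Pol_minimal) (simp_all add: monomial_in_Pol)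
  then show ?thesis using assms by blast
qed

lemma Pol_times_variable:
  assumes "f \<in> Pol n"
  shows "(\<lambda>t. t * f t) \<in> Pol (Suc n)"
proof -
  have "right_subspace {f. (\<lambda>t. t * f t) \<in> Pol (Suc n)}"
    using right_subspace_Pol[of "Suc n"]
    by (auto simp: right_subspace_def rscale_def plus_fun_def zero_fun_def distrib_left
        simp flip: mult.assoc)
  moreover have "(\<lambda>t. t * monomial r \<alpha> t) = monomial (Suc r) (case_nat 1 \<alpha>)" for r \<alpha>
  proof -
    have "[1..<Suc (Suc r)] = 1 # map Suc [1..<Suc r]"
      by (simp add: upt_conv_Cons map_Suc_upt del: upt_Suc)
    then show ?thesis
      by (simp add: monomial_def fun_eq_iff mult.assoc o_def del: upt_Suc)
  qed
  ultimately have "Pol n \<subseteq> {f. (\<lambda>t. t * f t) \<in> Pol (Suc n)}"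
    by (intro Pol_minimal) (simp_all add: monomial_in_Pol)
  then show ?thesis using assms by blast
qed

lemma Pol_mono: "m \<le> n \<Longrightarrow> Pol m \<subseteq> Pol n"
  by (intro Pol_minimal right_subspace_Pol monomial_in_Pol) simp


section \<open>Continuous families of quaternionic polynomials\<close>

lemma continuous_map_mult:
  fixes f g :: "'a \<Rightarrow> 'b::real_normed_algebra"
  assumes "continuous_map X euclidean f" "continuous_map X euclidean g"
  shows "continuous_map X euclidean (\<lambda>p. f p * g p)"
  using assms by (simp add: continuous_map_atin tendsto_mult)

lemma continuous_map_inverse:
  fixes f :: "'a \<Rightarrow> 'b::real_normed_div_algebra"
  assumes "continuous_map X euclidean f" "\<And>p. p \<in> topspace X \<Longrightarrow> f p \<noteq> 0"
  shows "continuous_map X euclidean (\<lambda>p. inverse (f p))"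
  using assms by (simp add: continuous_map_atin tendsto_inverse)

lemma continuous_map_scaleR_const:
  fixes f :: "'a \<Rightarrow> 'b::real_normed_vector"
  assumes "continuous_map X euclidean f"
  shows "continuous_map X euclidean (\<lambda>p. r *\<^sub>R f p)"
  using assms by (simp add: continuous_map_atin tendsto_scaleR)

lemma continuous_map_prod_list:
  fixes f :: "'k \<Rightarrow> 'a \<Rightarrow> 'b::real_normed_algebra_1"
  assumes "\<And>k. k \<in> set ks \<Longrightarrow> continuous_map X euclidean (f k)"
  shows "continuous_map X euclidean (\<lambda>p. prod_list (map (\<lambda>k. f k p) ks))"
  using assms by (induction ks) (simp_all add: continuous_map_mult)

lemma continuous_map_inner_const:
  fixes f :: "'a \<Rightarrow> 'b::real_inner"
  assumes "continuous_map X euclidean f"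
  shows "continuous_map X euclideanreal (\<lambda>p. f p \<bullet> e)"
  using assms by (simp add: continuous_map_atin tendsto_inner)

lemma continuous_map_findim_add:
  assumes "subspace W" "continuous_map X (findim_topology W) F" "continuous_map X (findim_topology W) G"
  shows "continuous_map X (findim_topology W) (\<lambda>p. F p + G p)"
  using assms
  by (auto simp: continuous_map_into_findim_topology linear_add image_subset_iff
      intro!: subspace_add continuous_map_add)

lemma continuous_map_findim_scaleR:
  assumes "subspace W" "continuous_map X euclideanreal r" "continuous_map X (findim_topology W) F"
  shows "continuous_map X (findim_topology W) (\<lambda>p. r p *\<^sub>R F p)"
  using assms
  by (auto simp: continuous_map_into_findim_topology linear_scale image_subset_iff
      intro!: subspace_scale continuous_map_real_mult)

lemma continuous_map_findim_sum:
  assumes "subspace W" "\<And>i. i \<in> I \<Longrightarrow> continuous_map X (findim_topology W) (F i)"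
  shows "continuous_map X (findim_topology W) (\<lambda>p. \<Sum>i\<in>I. F i p)"
  using assms(2)
proof (induction I rule: infinite_finite_induct)
  case (insert i I)
  then show ?case by (simp add: continuous_map_findim_add[OF assms(1)])
qed (use assms(1) in \<open>auto simp: continuous_map_into_findim_topology subspace_0\<close>)

text \<open>For this topology every linear map is continuous, because functionals pull back to functionals.\<close>

lemma continuous_map_findim_linear:
  assumes "linear T" "T ` V \<subseteq> W" "continuous_map X (findim_topology V) F"
  shows "continuous_map X (findim_topology W) (\<lambda>p. T (F p))"
proof -
  have "linear (\<lambda>v. \<phi> (T v))" if "linear \<phi>" for \<phi> :: "_ \<Rightarrow> real"
    using linear_compose[OF assms(1) that] by (simp add: o_def)
  then show ?thesis
    using assms(2,3) by (auto simp: continuous_map_into_findim_topology image_subset_iff)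
qed

lemma quat_expansion:
  "q = (\<Sum>e\<in>{1, Quat 0 1 0 0, Quat 0 0 1 0, Quat 0 0 0 1}. (q \<bullet> e) *\<^sub>R e)"
  by (simp add: quat_eq_iff inner_quat_def)

text \<open>Multiplication by a fixed quaternion is linear on \<open>Pol n\<close>, so a varying one is handled by
  expanding it into fixed quaternions with continuous real coefficients.\<close>

lemma continuous_map_Pol_rscale:
  assumes F: "continuous_map X (findim_topology (Pol n)) F" and v: "continuous_map X euclidean v"
  shows "continuous_map X (findim_topology (Pol n)) (\<lambda>p t. F p t * v p)"
proof -
  let ?E = "{1, Quat 0 1 0 0, Quat 0 0 1 0, Quat 0 0 0 1}"
  have "(\<lambda>p t. F p t * v p) = (\<lambda>p. \<Sum>e\<in>?E. (v p \<bullet> e) *\<^sub>R rscale (F p) e)"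
    by (intro ext, subst (1) quat_expansion)
      (simp only: sum_fun_apply scaleR_fun_def rscale_def sum_distrib_left mult_scaleR_right)
  moreover have "linear (\<lambda>f. rscale f e)" for e
    by (rule linearI) (simp_all add: rscale_def scaleR_fun_def fun_eq_iff distrib_right)
  moreover have "(\<lambda>f. rscale f e) ` Pol n \<subseteq> Pol n" for e
    using right_subspace_Pol[of n] by (auto simp: right_subspace_def)
  ultimately show ?thesis
    by (auto intro!: continuous_map_findim_sum continuous_map_findim_scaleR continuous_map_inner_const v
        right_subspace_imp_subspace right_subspace_Pol
        continuous_map_findim_linear[where T = "\<lambda>f. rscale f _", OF _ _ F] simp del: sum.insert)
qed

lemma continuous_map_Pol_left_mult:
  assumes F: "continuous_map X (findim_topology (Pol n)) F" and u: "continuous_map X euclidean u"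
  shows "continuous_map X (findim_topology (Pol n)) (\<lambda>p t. u p * F p t)"
proof -
  let ?E = "{1, Quat 0 1 0 0, Quat 0 0 1 0, Quat 0 0 0 1}"
  have "(\<lambda>p t. u p * F p t) = (\<lambda>p. \<Sum>e\<in>?E. (u p \<bullet> e) *\<^sub>R (\<lambda>t. e * F p t))"
    by (intro ext, subst (1) quat_expansion)
      (simp only: sum_fun_apply scaleR_fun_def sum_distrib_right mult_scaleR_left)
  moreover have "linear (\<lambda>f t. e * f t)" for e :: quat
    by (rule linearI) (simp_all add: scaleR_fun_def fun_eq_iff distrib_left)
  ultimately show ?thesis
    by (auto intro!: continuous_map_findim_sum continuous_map_findim_scaleR continuous_map_inner_const u
        right_subspace_imp_subspace right_subspace_Pol Pol_left_mult
        continuous_map_findim_linear[where T = "\<lambda>f t. _ * f t", OF _ _ F] simp del: sum.insert)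
qed

lemma continuous_map_Pol_linear_factor:
  assumes F: "continuous_map X (findim_topology (Pol n)) F" and u: "continuous_map X euclidean u"
  shows "continuous_map X (findim_topology (Pol (Suc n))) (\<lambda>p t. (t - u p) * F p t)"
proof -
  have sub: "subspace (Pol (Suc n))"
    by (intro right_subspace_imp_subspace right_subspace_Pol)
  have "linear (\<lambda>f t. t * f t :: quat)"
    by (rule linearI) (simp_all add: scaleR_fun_def fun_eq_iff distrib_left)
  then have 1: "continuous_map X (findim_topology (Pol (Suc n))) (\<lambda>p t. t * F p t)"
    by (rule continuous_map_findim_linear[OF _ _ F]) (auto intro: Pol_times_variable)
  have "continuous_map X (findim_topology (Pol n)) (\<lambda>p t. - u p * F p t)"
    by (intro continuous_map_Pol_left_mult F continuous_map_minus u)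
  then have 2: "continuous_map X (findim_topology (Pol (Suc n))) (\<lambda>p t. - u p * F p t)"
    using Pol_mono[of n "Suc n"] by (auto simp: continuous_map_into_findim_topology)
  show ?thesis
    using continuous_map_findim_add[OF sub 1 2] by (simp add: plus_fun_def algebra_simps)
qed

lemma continuous_map_Pol_prod_list:
  assumes "\<And>k. k \<in> set ks \<Longrightarrow> continuous_map X euclidean (u k)"
    "\<And>k. k \<in> set ks \<Longrightarrow> continuous_map X euclidean (v k)"
  shows "continuous_map X (findim_topology (Pol (length ks)))
    (\<lambda>p t. prod_list (map (\<lambda>k. (t - u k p) * v k p) ks))"
  using assms
proof (induction ks)
  case Nil
  have "(\<lambda>t. 1) = monomial 0 (\<lambda>_. 1)"
    by (simp add: monomial_def)
  then have "(\<lambda>t. 1) \<in> Pol 0"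
    by (simp add: monomial_in_Pol)
  then show ?case by (auto simp: continuous_map_into_findim_topology)
next
  case (Cons k ks)
  then show ?case
    by (auto simp: mult.assoc intro!: continuous_map_Pol_linear_factor continuous_map_Pol_left_mult)
qed

text \<open>For fixed \<open>n\<close> and \<open>j\<close> the index set of the sum does not vary with the points, unlike the set of
  orderings in \<open>node_poly_eq_sym_prod\<close>, so that continuity can be checked summand by summand. The
  factors 1 give it the shape of \<open>continuous_map_Pol_prod_list\<close>.\<close>

lemma node_poly_eq_sum:
  assumes "j \<le> n"
  shows "node_poly n x j t = (1 / fact n) *\<^sub>R
    (\<Sum>\<sigma> | \<sigma> permutes {..<n}. prod_list (map (\<lambda>i. (t - x (others n j ! \<sigma> i)) * 1) [0..<n]))"
  unfolding node_poly_def sym_poly_def length_map length_others[OF assms]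
  by (intro arg_cong[where f = "scaleR _"] sum.cong refl arg_cong[where f = prod_list] map_cong)
    (use length_others[OF assms] permutes_in_image in fastforce)

text \<open>The parameter space is arbitrary because the space of nodes contains only tuples that are
  undefined beyond \<open>n\<close>; a one-point space yields membership in \<open>Pol n\<close> for all tuples.\<close>

lemma continuous_map_ell:
  assumes j: "j \<le> n"
    and x: "\<And>i. i \<le> n \<Longrightarrow> continuous_map X euclidean (\<lambda>p. x p i)"
    and nodes: "\<And>p. p \<in> topspace X \<Longrightarrow> x p \<in> nodes c n"
  shows "continuous_map X (findim_topology (Pol n)) (\<lambda>p. ell c n (x p) j)"
proof -
  have sub: "subspace (Pol n)"
    by (intro right_subspace_imp_subspace right_subspace_Pol)
  show ?thesis
  proof (cases c)
    case Choice_I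
    \<comment> \<open>Outside the range of valid positions the list lookup would be an unspecified index.\<close>
    have others_le: "others n j ! \<sigma> i \<le> n" if "\<sigma> permutes {..<n}" "i < n" for \<sigma> i
    proof -
      have "\<sigma> i < length (others n j)"
        using that j permutes_in_image[OF that(1), of i] by (simp add: length_others)
      from nth_mem[OF this] show ?thesis by (simp add: set_others)
    qed
    have "continuous_map X (findim_topology (Pol (length [0..<n])))
        (\<lambda>p t. prod_list (map (\<lambda>i. (t - x p (others n j ! \<sigma> i)) * 1) [0..<n]))"
      if "\<sigma> permutes {..<n}" for \<sigma>
      by (rule continuous_map_Pol_prod_list[where u = "\<lambda>i p. x p (others n j ! \<sigma> i)"])
        (use others_le[OF that] in \<open>auto intro!: x\<close>)
    then have "continuous_map X (findim_topology (Pol n)) (\<lambda>p. (1 / fact n) *\<^sub>R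
        (\<Sum>\<sigma> | \<sigma> permutes {..<n}. (\<lambda>t. prod_list (map (\<lambda>i. (t - x p (others n j ! \<sigma> i)) * 1) [0..<n]))))"
      by (intro continuous_map_findim_scaleR continuous_map_findim_sum sub) auto
    then have "continuous_map X (findim_topology (Pol n)) (\<lambda>p. node_poly n (x p) j)"
      by (elim continuous_map_eq)
        (simp add: fun_eq_iff node_poly_eq_sum[OF j] sum_fun_apply scaleR_fun_def)
    moreover have "continuous_map X euclidean (\<lambda>p. node_poly n (x p) j (x p j))"
      unfolding node_poly_eq_sum[OF j]
      by (intro continuous_map_scaleR_const continuous_map_sum continuous_map_prod_list
          continuous_map_mult continuous_map_diff x j others_le)
        (auto simp: finite_permutations)
    ultimately have "continuous_map X (findim_topology (Pol n))
        (\<lambda>p t. node_poly n (x p) j t * inverse (node_poly n (x p) j (x p j)))"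
      by (intro continuous_map_Pol_rscale continuous_map_inverse)
        (use nodes j Choice_I in auto)
    then show ?thesis
      by (elim continuous_map_eq) (simp add: fun_eq_iff Choice_I)
  next
    case Choice_II
    have "continuous_map X (findim_topology (Pol (length (others n j))))
        (\<lambda>p t. prod_list (map (\<lambda>k. (t - x p (\<sigma> k)) * inverse (x p j - x p (\<sigma> k))) (others n j)))"
      if \<sigma>: "\<sigma> permutes {..n}" "\<sigma> j = j" for \<sigma>
    proof -
      have le: "\<sigma> k \<le> n" and ne: "\<sigma> k \<noteq> j" if "k \<in> set (others n j)" for k
        using that permutes_in_image[OF \<sigma>(1), of k] injD[OF permutes_inj[OF \<sigma>(1)], of k j] \<sigma>(2)
        by (auto simp: set_others)
      have "x p j - x p (\<sigma> k) \<noteq> 0" if "p \<in> topspace X" "k \<in> set (others n j)" for p k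
        using nodes[OF that(1)] le[OF that(2)] ne[OF that(2)] j
        by (auto simp: nodes_iff inj_on_eq_iff)
      then show ?thesis
        by (intro continuous_map_Pol_prod_list[where u = "\<lambda>k p. x p (\<sigma> k)"
              and v = "\<lambda>k p. inverse (x p j - x p (\<sigma> k))"]
            continuous_map_inverse continuous_map_diff x j le)
    qed
    then have "continuous_map X (findim_topology (Pol n)) (\<lambda>p. (1 / fact n) *\<^sub>R
        (\<Sum>\<sigma> | \<sigma> permutes {..n} \<and> \<sigma> j = j.
          (\<lambda>t. prod_list (map (\<lambda>k. (t - x p (\<sigma> k)) * inverse (x p j - x p (\<sigma> k))) (others n j)))))"
      by (intro continuous_map_findim_scaleR continuous_map_findim_sum sub)
        (auto simp: length_others j)
    then show ?thesis
      by (elim continuous_map_eq) (simp add: fun_eq_iff Choice_II sum_fun_apply scaleR_fun_def)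
  qed
qed

lemma ell_in_Pol:
  assumes "x \<in> nodes c n" "j \<le> n"
  shows "ell c n x j \<in> Pol n"
proof -
  have "continuous_map (discrete_topology {x}) (findim_topology (Pol n)) (\<lambda>p. ell c n p j)"
    by (rule continuous_map_ell) (use assms in auto)
  then show ?thesis by (simp add: continuous_map_into_findim_topology)
qed


section \<open>The interpolation space\<close>

lemma rindependent_ell:
  assumes "x \<in> nodes c n"
  shows "rindependent (Suc n) (ell c n x)"
  unfolding rindependent_def
proof (intro allI impI)
  fix \<alpha> i
  assume zero: "(\<Sum>j<Suc n. rscale (ell c n x j) (\<alpha> j)) = 0" and i: "i < Suc n"
  have "0 = (\<Sum>j<Suc n. rscale (ell c n x j) (\<alpha> j)) (x i)"
    by (simp only: zero zero_fun_def)
  also have "\<dots> = (\<Sum>j<Suc n. if i = j then \<alpha> j else 0)"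
    unfolding sum_fun_apply by (intro sum.cong refl) (use assms i in \<open>simp add: rscale_def ell_at_node\<close>)
  also have "\<dots> = \<alpha> i" using i by (simp del: sum.lessThan_Suc)
  finally show "\<alpha> i = 0" ..
qed

lemma lagrange_op_eq_sum_rscale: "lagrange_op c n x f = (\<Sum>j\<le>n. rscale (ell c n x j) (f (x j)))"
  by (simp add: lagrange_op_def fun_eq_iff sum_fun_apply rscale_def)

lemma range_lagrange_op:
  assumes "inj_on x {..n}"
  shows "range (lagrange_op c n x) = frame_span (Suc n) (ell c n x)"
proof
  show "range (lagrange_op c n x) \<subseteq> frame_span (Suc n) (ell c n x)"
  proof safe
    fix f
    have "rscale (ell c n x j) (f (x j)) \<in> rspan (ell c n x ` {..<Suc n})" if "j \<le> n" for j
    proof -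
      have "ell c n x j \<in> rspan (ell c n x ` {..<Suc n})"
        by (rule subsetD[OF rspan_superset]) (use that in auto)
      then show ?thesis
        using right_subspace_rspan by (simp only: right_subspace_def)
    qed
    then show "lagrange_op c n x f \<in> frame_span (Suc n) (ell c n x)"
      unfolding frame_span_def lagrange_op_eq_sum_rscale
      by (intro right_subspace_sum right_subspace_rspan) simp
  qed
  have lin: "0 = lagrange_op c n x 0"
    "lagrange_op c n x f + lagrange_op c n x g = lagrange_op c n x (f + g)"
    "rscale (lagrange_op c n x f) \<alpha> = lagrange_op c n x (rscale f \<alpha>)" for f g \<alpha>
    by (simp_all add: lagrange_op_def rscale_def fun_eq_iff sum.distrib distrib_left sum_distrib_right
        mult.assoc)
  have "right_subspace (range (lagrange_op c n x))"
    unfolding right_subspace_def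
  proof (intro conjI ballI allI)
    show "0 \<in> range (lagrange_op c n x)"
      by (rule range_eqI[where x = 0]) (rule lin(1))
  qed (auto simp: lin(2,3))
  moreover have "ell c n x j \<in> range (lagrange_op c n x)" if "j \<le> n" for j
  proof
    \<comment> \<open>\<open>\<ell>\<^sub>j\<close> interpolates the indicator function of the \<open>j\<close>-th point.\<close>
    have "lagrange_op c n x (\<lambda>s. if s = x j then 1 else 0) = (\<lambda>t. \<Sum>i\<le>n. if i = j then ell c n x i t else 0)"
      unfolding lagrange_op_def
      by (intro ext sum.cong refl) (use assms that in \<open>auto simp: inj_on_eq_iff\<close>)
    then show "ell c n x j = lagrange_op c n x (\<lambda>s. if s = x j then 1 else 0)"
      using that by simp
  qed simp
  ultimately show "frame_span (Suc n) (ell c n x) \<subseteq> range (lagrange_op c n x)"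
    unfolding frame_span_def by (intro rspan_minimal) (auto simp: less_Suc_eq_le)
qed

text \<open>Frames live in an extensional function space, so \<open>ell c n x\<close> has to be cut off at \<open>n\<close>.\<close>

lemma frame_span_restrict: "frame_span k (restrict b {..<k}) = frame_span k b"
  by (simp add: frame_span_def)

lemma rindependent_restrict: "rindependent k (restrict b {..<k}) \<longleftrightarrow> rindependent k b"
  by (simp add: rindependent_def)

lemma ell_frame:
  assumes "x \<in> nodes c n"
  shows "restrict (ell c n x) {..<Suc n} \<in> topspace (frame_topology (Suc n) (Pol n))"
  using assms
  by (auto simp: frame_topology_def rindependent_restrict rindependent_ell ell_in_Pol less_Suc_eq_le
      simp del: restrict_apply)

lemma continuous_map_frame_span:
  "continuous_map (frame_topology k V) (grassmannian_topology k V) (frame_span k)"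
  by (auto simp: continuous_map_def openin_grassmannian_topology grassmannian_def)

lemma continuous_map_nodes_ell:
  assumes "j \<le> n"
  shows "continuous_map (nodes_topology c n) (findim_topology (Pol n)) (\<lambda>x. ell c n x j)"
proof (rule continuous_map_ell[OF assms])
  fix i assume "i \<le> n"
  then show "continuous_map (nodes_topology c n) euclidean (\<lambda>x. x i)"
    unfolding nodes_topology_def
    by (intro continuous_map_from_subtopology continuous_map_product_coordinates) simp
qed (simp add: nodes_topology_def)

lemma continuous_map_range_lagrange_op:
  "continuous_map (nodes_topology c n) (grassmannian_topology (Suc n) (Pol n))
    (\<lambda>x. range (lagrange_op c n x))"
proof -
  have top: "topspace (nodes_topology c n) \<subseteq> nodes c n"
    by (auto simp: nodes_topology_def)
  have "continuous_map (nodes_topology c n) (frame_topology (Suc n) (Pol n))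
      (\<lambda>x. restrict (ell c n x) {..<Suc n})"
    unfolding frame_topology_def continuous_map_in_subtopology
  proof
    show "continuous_map (nodes_topology c n) (product_topology (\<lambda>_. findim_topology (Pol n)) {..<Suc n})
        (\<lambda>x. restrict (ell c n x) {..<Suc n})"
      by (auto simp: continuous_map_componentwise less_Suc_eq_le continuous_map_nodes_ell)
    show "(\<lambda>x. restrict (ell c n x) {..<Suc n}) \<in> topspace (nodes_topology c n) \<rightarrow> {b. rindependent (Suc n) b}"
      using top by (auto simp: rindependent_restrict rindependent_ell simp del: restrict_apply)
  qed
  from continuous_map_compose[OF this continuous_map_frame_span] show ?thesis
  proof (rule continuous_map_eq)
    fix x assume "x \<in> topspace (nodes_topology c n)"
    then have "inj_on x {..n}" using top by (auto simp: nodes_iff)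
    then show "(frame_span (Suc n) \<circ> (\<lambda>x. restrict (ell c n x) {..<Suc n})) x = range (lagrange_op c n x)"
      by (simp only: o_def frame_span_restrict range_lagrange_op)
  qed
qed


section \<open>The interpolation theorem\<close>

theorem mainTheorem2:
  fixes c :: lagrange_choice and n :: nat
  assumes "n \<ge> 1"
  shows
    "(\<forall>x\<in>nodes c n. \<forall>f. \<forall>j\<le>n. lagrange_op c n x f (x j) = f (x j)) \<and>
     (\<forall>x\<in>nodes c n. \<forall>y. inj_on y {..n} \<and> y ` {..n} = x ` {..n} \<longrightarrow>
        y \<in> nodes c n \<and> lagrange_op c n y = lagrange_op c n x) \<and>
     (\<forall>x\<in>nodes c n. \<forall>j\<le>n. ell c n x j \<in> Pol n) \<and>
     (\<forall>j\<le>n. continuous_map (nodes_topology c n) (findim_topology (Pol n)) (\<lambda>x. ell c n x j)) \<and>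
     (\<forall>x\<in>nodes c n. range (lagrange_op c n x) \<in> grassmannian (Suc n) (Pol n)) \<and>
     continuous_map (nodes_topology c n) (grassmannian_topology (Suc n) (Pol n))
       (\<lambda>x. range (lagrange_op c n x)) \<and>
     (\<forall>x\<in>nodes c n. \<forall>a. (\<lambda>i. x i + a) \<in> nodes c n \<and>
        (\<forall>f t. lagrange_op c n (\<lambda>i. x i + a) f t = lagrange_op c n x (\<lambda>s. f (s + a)) (t - a)))"
proof (intro conjI ballI allI impI)
  fix x f j
  assume "x \<in> nodes c n" "j \<le> n"
  then show "lagrange_op c n x f (x j) = f (x j)" by (rule lagrange_op_interpolates)
next
  fix x y
  assume x: "x \<in> nodes c n" and y: "inj_on y {..n} \<and> y ` {..n} = x ` {..n}"
  then show "y \<in> nodes c n" by (simp add: nodes_iff)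
  show "lagrange_op c n y = lagrange_op c n x"
    using x y by (simp add: fun_eq_iff lagrange_op_eq_sum_set nodes_iff)
next
  fix x j
  assume "x \<in> nodes c n" "j \<le> n"
  then show "ell c n x j \<in> Pol n" by (rule ell_in_Pol)
next
  fix j
  assume "j \<le> n"
  then show "continuous_map (nodes_topology c n) (findim_topology (Pol n)) (\<lambda>x. ell c n x j)"
    by (rule continuous_map_nodes_ell)
next
  fix x
  assume x: "x \<in> nodes c n"
  then have "range (lagrange_op c n x) = frame_span (Suc n) (restrict (ell c n x) {..<Suc n})"
    by (simp add: range_lagrange_op nodes_iff frame_span_restrict)
  then show "range (lagrange_op c n x) \<in> grassmannian (Suc n) (Pol n)"
    unfolding grassmannian_def using ell_frame[OF x] by blast
next
  show "continuous_map (nodes_topology c n) (grassmannian_topology (Suc n) (Pol n))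
      (\<lambda>x. range (lagrange_op c n x))"
    by (rule continuous_map_range_lagrange_op)
next
  fix x a
  assume x: "x \<in> nodes c n"
  have img: "(\<lambda>i. x i + a) ` {..n} = (\<lambda>z. z + a) ` x ` {..n}"
    by (simp add: image_image)
  show xa: "(\<lambda>i. x i + a) \<in> nodes c n"
    using x by (simp add: nodes_iff img admissible_translate inj_on_def)
  fix f t
  show "lagrange_op c n (\<lambda>i. x i + a) f t = lagrange_op c n x (\<lambda>s. f (s + a)) (t - a)"
    using x xa
    by (simp add: lagrange_op_eq_sum_set nodes_iff img sum.reindex fundamental_translate)
qed

end
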